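(* There is an infinite binary tree $T\subseteq 2^{<\omega}$ that is computable but does not have a computable branch.
   Context: $2^{<\omega}$ is the set of finite sequences with entries from $\{0,1\}$; $\sigma\sqsubset\tau$ means that $\sigma$ is a proper initial segment of $\tau$. A binary tree is a nonempty set $T\subseteq 2^{<\omega}$ such that $\sigma\sqsubset\tau\in T$ entails $\sigma\in T$. A branch of $T$ is a function $f:\mathbb N\to\{0,1\}$ with $\langle f(0),\ldots,f(n-1)\rangle\in T$ for all $n\in\mathbb N$. Via a fixed primitive recursive coding of finite sequences of natural numbers by natural numbers, a tree is viewed as a subset of $\mathbb N$; a set is computable if its characteristic function is computable. *)

theory Defs
  imports Main "HOL-Library.Nat_Bijection" "HOL-Library.Sublist"
begin

text \<open>
  Partial recursive functions, as programs built from the basic functions by composition,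
  primitive recursion and unbounded minimization. Programs carry no arity: at each length of
  the argument list a program denotes one partial function, and a program used at an
  unsuitable length (such as \<open>Succ\<close> at a length other than 1) is undefined there.
\<close>

datatype prog =
    Zero
  | Succ
  | Proj nat
  | Comp prog "prog list"
  | PrimRec prog prog
  | Mu prog

text \<open>\<open>evaluates p xs y\<close>: the partial function denoted by \<open>p\<close> is defined at \<open>xs\<close> with value \<open>y\<close>.\<close>

inductive evaluates :: "prog \<Rightarrow> nat list \<Rightarrow> nat \<Rightarrow> bool" where
  Zero: "evaluates Zero xs 0"
| Succ: "evaluates Succ [x] (Suc x)"
| Proj: "i < length xs \<Longrightarrow> evaluates (Proj i) xs (xs ! i)"
| Comp: "length ys = length gs \<Longrightarrow> (\<And>i. i < length gs \<Longrightarrow> evaluates (gs ! i) xs (ys ! i)) \<Longrightarrow>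
    evaluates f ys y \<Longrightarrow> evaluates (Comp f gs) xs y"
| PrimRec_0: "evaluates f xs y \<Longrightarrow> evaluates (PrimRec f g) (0 # xs) y"
| PrimRec_Suc: "evaluates (PrimRec f g) (n # xs) r \<Longrightarrow> evaluates g (n # r # xs) y \<Longrightarrow>
    evaluates (PrimRec f g) (Suc n # xs) y"
| Mu: "evaluates f (n # xs) 0 \<Longrightarrow> (\<And>m. m < n \<Longrightarrow> \<exists>k. evaluates f (m # xs) (Suc k)) \<Longrightarrow>
    evaluates (Mu f) xs n"

inductive_cases evaluates_ZeroE: "evaluates Zero xs y"
inductive_cases evaluates_SuccE: "evaluates Succ xs y"
inductive_cases evaluates_ProjE: "evaluates (Proj i) xs y"
inductive_cases evaluates_CompE: "evaluates (Comp f gs) xs y"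
inductive_cases evaluates_PrimRec_0E: "evaluates (PrimRec f g) (0 # xs) y"
inductive_cases evaluates_PrimRec_SucE: "evaluates (PrimRec f g) (Suc n # xs) y"
inductive_cases evaluates_MuE: "evaluates (Mu f) xs n"

lemma evaluates_deterministic:
  "evaluates p xs y \<Longrightarrow> evaluates p xs z \<Longrightarrow> y = z"
proof (induction arbitrary: z rule: evaluates.induct)
  case (Zero xs)
  then show ?case by (elim evaluates_ZeroE) simp
next
  case (Succ x)
  then show ?case by (elim evaluates_SuccE) simp
next
  case (Proj i xs)
  from Proj.prems show ?case by (elim evaluates_ProjE) simp
next
  case (Comp ys gs xs f y)
  from Comp.prems obtain zs where zs: "length zs = length gs"
    "\<And>i. i < length gs \<Longrightarrow> evaluates (gs ! i) xs (zs ! i)" "evaluates f zs z"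
    by (elim evaluates_CompE) blast
  have "ys = zs"
  proof (rule nth_equalityI)
    show "length ys = length zs"
      using Comp.hyps zs(1) by simp
    show "ys ! i = zs ! i" if "i < length ys" for i
      using that Comp.IH(1)[of i] zs(2)[of i] Comp.hyps(1) by metis
  qed
  then show ?case
    using zs(3) Comp.IH(2) by blast
next
  case (PrimRec_0 f xs y g)
  from PrimRec_0.prems show ?case
    by (elim evaluates_PrimRec_0E) (rule PrimRec_0.IH)
next
  case (PrimRec_Suc f g n xs r y)
  from PrimRec_Suc.prems show ?case
  proof (rule evaluates_PrimRec_SucE)
    fix r'
    assume "evaluates (PrimRec f g) (n # xs) r'" "evaluates g (n # r' # xs) z"
    then show "y = z" using PrimRec_Suc.IH by blast
  qed
next
  case (Mu f n xs)
  from Mu.prems show ?case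
  proof (rule evaluates_MuE)
    assume z: "evaluates f (z # xs) 0" "\<And>m. m < z \<Longrightarrow> \<exists>k. evaluates f (m # xs) (Suc k)"
    show "n = z"
    proof (rule linorder_cases[of n z])
      assume "n < z"
      with z(2) obtain k where "evaluates f (n # xs) (Suc k)" by blast
      then show ?thesis using Mu.IH(1)[of "Suc k"] by simp
    next
      assume "z < n"
      with Mu.IH(2) obtain k where "\<And>w. evaluates f (z # xs) w \<Longrightarrow> Suc k = w" by blast
      from this[OF z(1)] show ?thesis by simp
    qed
  qed
qed

definition computable :: "(nat \<Rightarrow> nat) \<Rightarrow> bool" where
  "computable f \<longleftrightarrow> (\<exists>p. \<forall>x. evaluates p [x] (f x))"

definition computable_set :: "nat set \<Rightarrow> bool" where
  "computable_set A \<longleftrightarrow> computable (\<lambda>n. if n \<in> A then 1 else 0)"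

definition binary_tree :: "nat list set \<Rightarrow> bool" where
  "binary_tree T \<longleftrightarrow> T \<noteq> {} \<and> (\<forall>\<sigma>\<in>T. set \<sigma> \<subseteq> {0, 1}) \<and>
    (\<forall>\<sigma> \<tau>. strict_prefix \<sigma> \<tau> \<and> \<tau> \<in> T \<longrightarrow> \<sigma> \<in> T)"

text \<open>The fixed coding of finite sequences of natural numbers is \<open>list_encode\<close>.\<close>

definition computable_tree :: "nat list set \<Rightarrow> bool" where
  "computable_tree T \<longleftrightarrow> computable_set (list_encode ` T)"

definition branch :: "nat list set \<Rightarrow> (nat \<Rightarrow> nat) \<Rightarrow> bool" where
  "branch T f \<longleftrightarrow> range f \<subseteq> {0, 1} \<and> (\<forall>n. map f [0..<n] \<in> T)"

end

theory Submission
  imports Defs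
begin

text \<open>
  A derivation of an evaluation is a finite list of judgments, each following from earlier ones by
  a rule of \<open>evaluates\<close>; on codes, being a derivation is decidable. Hence the relation
  ``within \<open>s\<close> steps, program \<open>e\<close> is seen to have value \<open>v\<close> at \<open>e\<close>'' is computable, and so is the
  tree of all binary \<open>\<sigma>\<close> for which no \<open>e < |\<sigma>|\<close> is seen within \<open>|\<sigma>|\<close> steps to have value \<open>\<sigma>(e)\<close>
  at \<open>e\<close>. Its branches disagree with the \<open>e\<close>-th computable function at \<open>e\<close>, for every \<open>e\<close>.
\<close>

section \<open>Closure properties of computable functions\<close>

text \<open>Functions take their arguments from an environment \<open>e\<close>, of which only the first \<open>k\<close> entries
  count; a bound variable is entry 0 of an extended environment.\<close>

definition recfn :: "nat \<Rightarrow> ((nat \<Rightarrow> nat) \<Rightarrow> nat) \<Rightarrow> bool" where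
  "recfn k F \<longleftrightarrow> (\<exists>p. \<forall>e. evaluates p (map e [0..<k]) (F e))"

definition recpred :: "nat \<Rightarrow> ((nat \<Rightarrow> nat) \<Rightarrow> bool) \<Rightarrow> bool" where
  "recpred k P \<longleftrightarrow> recfn k (\<lambda>e. of_bool (P e))"

named_theorems recfn_intros

lemma recfn_var [recfn_intros]: "i < k \<Longrightarrow> recfn k (\<lambda>e. e i)"
  unfolding recfn_def using evaluates.Proj[of i "map _ [0..<k]"] by (metis add_0 length_map length_upt diff_zero nth_map_upt)

text \<open>The program for \<open>G\<close> reads only the first \<open>m\<close> entries, so the
  infinite environment \<open>\<lambda>i. H i e\<close> needs computable entries only below
  \<open>m\<close>.\<close>

lemma recfn_comp:
  assumes "recfn m G" and "\<And>i. i < m \<Longrightarrow> recfn k (H i)"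
  shows "recfn k (\<lambda>e. G (\<lambda>i. H i e))"
proof -
  obtain p where p: "\<And>e. evaluates p (map e [0..<m]) (G e)"
    using assms(1) unfolding recfn_def by blast
  have "\<forall>i. \<exists>q. i < m \<longrightarrow> (\<forall>e. evaluates q (map e [0..<k]) (H i e))"
    using assms(2) unfolding recfn_def by blast
  then obtain q where q: "\<And>i e. i < m \<Longrightarrow> evaluates (q i) (map e [0..<k]) (H i e)"
    by metis
  have "evaluates (Comp p (map q [0..<m])) (map e [0..<k]) (G (\<lambda>i. H i e))" for e
    by (rule evaluates.Comp[where ys = "map (\<lambda>i. H i e) [0..<m]"]) (simp_all add: p q)
  then show ?thesis unfolding recfn_def by blast
qed

lemma recfn_comp1: "recfn k A \<Longrightarrow> recfn 1 (\<lambda>e. g (e 0)) \<Longrightarrow> recfn k (\<lambda>e. g (A e))"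
  using recfn_comp[of 1 "\<lambda>e. g (e 0)" k "\<lambda>_. A"] by simp

lemma recfn_comp2:
  "recfn k A \<Longrightarrow> recfn k B \<Longrightarrow> recfn 2 (\<lambda>e. g (e 0) (e 1)) \<Longrightarrow> recfn k (\<lambda>e. g (A e) (B e))"
  using recfn_comp[of 2 "\<lambda>e. g (e 0) (e 1)" k "\<lambda>i. if i = 0 then A else B"] by simp

lemma recfn_Suc [recfn_intros]: "recfn k A \<Longrightarrow> recfn k (\<lambda>e. Suc (A e))"
proof (erule recfn_comp1)
  have "evaluates Succ (map e [0..<1]) (Suc (e 0))" for e
    by (simp add: evaluates.Succ)
  then show "recfn 1 (\<lambda>e. Suc (e 0))" unfolding recfn_def by blast
qed

lemma recfn_const [recfn_intros]: "recfn k (\<lambda>e. c)"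
proof (induction c)
  case 0
  show ?case unfolding recfn_def using evaluates.Zero by blast
qed (rule recfn_Suc)

lemma recfn_rec_nat [recfn_intros]:
  assumes "recfn k A" and "recfn (Suc (Suc k)) (\<lambda>e. G (e 0) (e 1) (\<lambda>i. e (Suc (Suc i))))"
    and "recfn k N"
  shows "recfn k (\<lambda>e. rec_nat (A e) (\<lambda>n r. G n r e) (N e))"
proof -
  obtain p where p: "\<And>e. evaluates p (map e [0..<k]) (A e)"
    using assms(1) unfolding recfn_def by blast
  obtain q where q: "\<And>e. evaluates q (map e [0..<Suc (Suc k)]) (G (e 0) (e 1) (\<lambda>i. e (Suc (Suc i))))"
    using assms(2) unfolding recfn_def by blast
  \<comment> \<open>The environment \<open>e\<close> with \<open>n\<close> and \<open>r\<close>
    pushed in front, in the order in which \<open>PrimRec\<close> passes counter and previous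
    value.\<close>
  have q': "evaluates q (n # r # map e [0..<k]) (G n r e)" for n r e
    using q[of "case_nat n (case_nat r e)"] by (simp add: map_upt_Suc del: upt_Suc)
  have rec: "evaluates (PrimRec p q) (n # map e [0..<k]) (rec_nat (A e) (\<lambda>n r. G n r e) n)" for n e
  proof (induction n)
    case 0
    then show ?case by (simp add: evaluates.PrimRec_0 p)
  next
    case (Suc n)
    then show ?case using evaluates.PrimRec_Suc[OF Suc q'] by simp
  qed
  have "evaluates (PrimRec p q) (map e [0..<Suc k])
      (rec_nat (A (\<lambda>i. e (Suc i))) (\<lambda>n r. G n r (\<lambda>i. e (Suc i))) (e 0))" for e
    using rec[of "e 0" "\<lambda>i. e (Suc i)"] by (simp add: map_upt_Suc del: upt_Suc)
  then have "recfn (Suc k) (\<lambda>e. rec_nat (A (\<lambda>i. e (Suc i))) (\<lambda>n r. G n r (\<lambda>i. e (Suc i))) (e 0))"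
    unfolding recfn_def by blast
  from recfn_comp[OF this, of k "case_nat N (\<lambda>i e. e i)"] assms(3)
  show ?thesis by (simp add: recfn_var split: nat.split)
qed

lemma recfn_add [recfn_intros]: "recfn k A \<Longrightarrow> recfn k B \<Longrightarrow> recfn k (\<lambda>e. A e + B e)"
proof (erule (1) recfn_comp2)
  have "rec_nat a (\<lambda>n r. Suc r) b = a + b" for a b by (induction b) simp_all
  then show "recfn 2 (\<lambda>e. e 0 + e 1)"
    using recfn_rec_nat[of 2 "\<lambda>e. e 0" "\<lambda>n r e. Suc r" "\<lambda>e. e 1"] by (simp add: recfn_intros)
qed

lemma recfn_mult [recfn_intros]: "recfn k A \<Longrightarrow> recfn k B \<Longrightarrow> recfn k (\<lambda>e. A e * B e)"
proof (erule (1) recfn_comp2)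
  have "rec_nat 0 (\<lambda>n r. a + r) b = a * b" for a b :: nat by (induction b) simp_all
  then show "recfn 2 (\<lambda>e. e 0 * e 1)"
    using recfn_rec_nat[of 2 "\<lambda>e. 0" "\<lambda>n r e. e 0 + r" "\<lambda>e. e 1"] by (simp add: recfn_intros)
qed

lemma recfn_pred [recfn_intros]: "recfn k A \<Longrightarrow> recfn k (\<lambda>e. A e - 1)"
proof (erule recfn_comp1)
  have "rec_nat 0 (\<lambda>n r. n) b = b - 1" for b by (induction b) simp_all
  then show "recfn 1 (\<lambda>e. e 0 - 1)"
    using recfn_rec_nat[of 1 "\<lambda>e. 0" "\<lambda>n r e. n" "\<lambda>e. e 0"] by (simp add: recfn_intros)
qed

lemma recfn_diff [recfn_intros]: "recfn k A \<Longrightarrow> recfn k B \<Longrightarrow> recfn k (\<lambda>e. A e - B e)"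
proof (erule (1) recfn_comp2)
  have "rec_nat a (\<lambda>n r. r - 1) b = a - b" for a b :: nat by (induction b) simp_all
  then show "recfn 2 (\<lambda>e. e 0 - e 1)"
    using recfn_rec_nat[of 2 "\<lambda>e. e 0" "\<lambda>n r e. r - 1" "\<lambda>e. e 1"] recfn_pred[of 4 "\<lambda>e. e 1"]
    by (simp add: recfn_intros)
qed

section \<open>Decidable predicates, bounded quantifiers, unbounded search\<close>

lemma recpred_not [recfn_intros]: "recpred k P \<Longrightarrow> recpred k (\<lambda>e. \<not> P e)"
proof -
  assume "recpred k P"
  moreover have "of_bool (\<not> b) = (1::nat) - of_bool b" for b by simp
  ultimately show ?thesis
    unfolding recpred_def by (simp only: recfn_diff recfn_const)
qed

lemma recpred_conj [recfn_intros]: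
  "recpred k P \<Longrightarrow> recpred k Q \<Longrightarrow> recpred k (\<lambda>e. P e \<and> Q e)"
  unfolding recpred_def of_bool_conj by (rule recfn_mult)

lemma recpred_disj [recfn_intros]:
  assumes "recpred k P" "recpred k Q"
  shows "recpred k (\<lambda>e. P e \<or> Q e)"
proof -
  have "recpred k (\<lambda>e. \<not> (\<not> P e \<and> \<not> Q e))" by (intro recpred_not recpred_conj assms)
  then show ?thesis by simp
qed

lemma recpred_imp [recfn_intros]:
  assumes "recpred k P" "recpred k Q"
  shows "recpred k (\<lambda>e. P e \<longrightarrow> Q e)"
  unfolding imp_conv_disj by (intro recpred_disj recpred_not assms)

lemma recpred_less [recfn_intros]:
  "recfn k A \<Longrightarrow> recfn k B \<Longrightarrow> recpred k (\<lambda>e. A e < B e)"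
proof -
  assume "recfn k A" "recfn k B"
  \<comment> \<open>With truncated subtraction, \<open>Suc a - b\<close> is 0 exactly when
    \<open>a < b\<close>.\<close>
  moreover have "of_bool (a < b) = 1 - (Suc a - b)" for a b :: nat by auto
  ultimately show ?thesis
    unfolding recpred_def by (simp only: recfn_diff recfn_Suc recfn_const)
qed

lemma recpred_le [recfn_intros]:
  "recfn k A \<Longrightarrow> recfn k B \<Longrightarrow> recpred k (\<lambda>e. A e \<le> B e)"
  unfolding less_Suc_eq_le[symmetric] by (intro recpred_less recfn_Suc)

lemma recpred_eq [recfn_intros]:
  "recfn k A \<Longrightarrow> recfn k B \<Longrightarrow> recpred k (\<lambda>e. A e = B e)"
  unfolding eq_iff by (intro recpred_conj recpred_le)

lemma recpred_ball [recfn_intros]: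
  assumes "recfn k N" and "recpred (Suc k) (\<lambda>e. P (e 0) (\<lambda>i. e (Suc i)))"
  shows "recpred k (\<lambda>e. \<forall>n<N e. P n e)"
proof -
  have eq: "of_bool (\<forall>n<N e. P n e) = rec_nat (1::nat) (\<lambda>n r. r * of_bool (P n e)) (N e)" for e
  proof -
    have "rec_nat (1::nat) (\<lambda>n r. r * of_bool (P n e)) b = of_bool (\<forall>n<b. P n e)" for b
      by (induction b) (auto simp: less_Suc_eq)
    then show ?thesis by (rule sym)
  qed
  \<comment> \<open>The recursion step carries one more variable than \<open>P\<close>: entry 1, the
    product so far, is skipped.\<close>
  have "recfn (Suc (Suc k)) (\<lambda>e. of_bool (P (e 0) (\<lambda>i. e (Suc (Suc i)))))"
    using recfn_comp[OF assms(2)[unfolded recpred_def], of "Suc (Suc k)"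
        "case_nat (\<lambda>e. e 0) (\<lambda>i e. e (Suc (Suc i)))"]
    by (simp add: recfn_var split: nat.split)
  then show ?thesis
    unfolding recpred_def eq using assms(1)
    by (intro recfn_rec_nat recfn_mult) (simp_all add: recfn_intros)
qed

lemma recpred_bex [recfn_intros]:
  assumes "recfn k N" and "recpred (Suc k) (\<lambda>e. P (e 0) (\<lambda>i. e (Suc i)))"
  shows "recpred k (\<lambda>e. \<exists>n<N e. P n e)"
proof -
  have "recpred k (\<lambda>e. \<not> (\<forall>n<N e. \<not> P n e))"
    by (intro recpred_not recpred_ball assms)
  then show ?thesis by simp
qed

text \<open>\<open>Mu\<close> looks for a zero, hence it is applied to the truth value of the
  negation. That value is defined everywhere, as the rule for \<open>Mu\<close> demands below the
  zero, and \<open>ex\<close> makes the search end.\<close>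

lemma recfn_Least [recfn_intros]:
  assumes "recpred (Suc k) (\<lambda>e. P (e 0) (\<lambda>i. e (Suc i)))" and ex: "\<And>e. \<exists>n. P n e"
  shows "recfn k (\<lambda>e. LEAST n. P n e)"
proof -
  obtain p where p: "\<And>e. evaluates p (map e [0..<Suc k]) (of_bool (\<not> P (e 0) (\<lambda>i. e (Suc i))))"
    using recpred_not[OF assms(1)] unfolding recpred_def recfn_def by blast
  have p': "evaluates p (n # map e [0..<k]) (of_bool (\<not> P n e))" for n e
    using p[of "case_nat n e"] by (simp add: map_upt_Suc del: upt_Suc)
  have "evaluates (Mu p) (map e [0..<k]) (LEAST n. P n e)" for e
  proof (rule evaluates.Mu)
    show "evaluates p ((LEAST n. P n e) # map e [0..<k]) 0"
      using p'[of "LEAST n. P n e" e] LeastI_ex[OF ex[of e]] by simp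
    show "\<exists>l. evaluates p (m # map e [0..<k]) (Suc l)" if "m < (LEAST n. P n e)" for m
      using p'[of m e] not_less_Least[OF that] by auto
  qed
  then show ?thesis unfolding recfn_def by blast
qed

section \<open>Computing with codes of pairs and lists\<close>

definition pair :: "nat \<Rightarrow> nat \<Rightarrow> nat" where "pair a b = prod_encode (a, b)"

definition code_cons :: "nat \<Rightarrow> nat \<Rightarrow> nat" where "code_cons a b = Suc (pair a b)"

text \<open>Subtracting 1 undoes the successor in \<open>code_cons\<close>. At 0, the code of the
  empty list, the result is 0 again, since 0 codes the pair of zeros.\<close>

definition code_tl :: "nat \<Rightarrow> nat" where "code_tl n = snd (prod_decode (n - 1))"

definition code_drop :: "nat \<Rightarrow> nat \<Rightarrow> nat" where
  "code_drop n i = rec_nat n (\<lambda>_. code_tl) i"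

definition code_nth :: "nat \<Rightarrow> nat \<Rightarrow> nat" where
  "code_nth n i = fst (prod_decode (code_drop n i - 1))"

text \<open>Only the empty list has code 0, so the first vanishing tail gives the length, in a form
  that \<open>recfn_Least\<close> can treat.\<close>

definition code_length :: "nat \<Rightarrow> nat" where
  "code_length n = (LEAST i. code_drop n i = 0)"

lemma pair_eq_iff [simp]: "pair a b = pair c d \<longleftrightarrow> a = c \<and> b = d"
  by (simp add: pair_def)

lemma code_cons_eq_iff [simp]: "code_cons a b = code_cons c d \<longleftrightarrow> a = c \<and> b = d"
  by (simp add: code_cons_def)

lemma list_encode_Cons: "list_encode (x # xs) = code_cons x (list_encode xs)"
  by (simp add: code_cons_def pair_def)

lemma list_encode_eq_cons:
  "list_encode xs = code_cons a b \<longleftrightarrow> xs = a # list_decode b"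
proof -
  have "code_cons a b = list_encode (a # list_decode b)"
    by (simp add: code_cons_def pair_def)
  then show ?thesis by (simp only: list_encode_eq)
qed

lemma code_drop_list_encode: "code_drop (list_encode xs) i = list_encode (drop i xs)"
proof (induction i)
  case 0
  then show ?case by (simp add: code_drop_def)
next
  case (Suc i)
  have "code_tl (list_encode ys) = list_encode (tl ys)" for ys
  proof (cases ys)
    case Nil
    have "prod_decode 0 = (0, 0)"
      using prod_encode_inverse[of "(0, 0)"] by (simp add: prod_encode_def del: prod_encode_inverse)
    then show ?thesis using Nil by (simp add: code_tl_def)
  next
    case (Cons x zs)
    then show ?thesis by (simp add: code_tl_def)
  qed
  then show ?case using Suc by (simp add: code_drop_def drop_Suc tl_drop)
qed

lemma code_nth_list_encode [simp]: "i < length xs \<Longrightarrow> code_nth (list_encode xs) i = xs ! i"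
  by (simp add: code_nth_def code_drop_list_encode Cons_nth_drop_Suc[symmetric])

lemma code_length_list_encode [simp]: "code_length (list_encode xs) = length xs"
proof -
  have "list_encode ys = 0 \<longleftrightarrow> ys = []" for ys by (cases ys) simp_all
  then have "(LEAST i. list_encode (drop i xs) = 0) = length xs"
    by (intro Least_equality) simp_all
  then show ?thesis by (simp only: code_length_def code_drop_list_encode)
qed

lemma ex_code_drop_0: "\<exists>i. code_drop n i = 0"
proof -
  have "code_drop n (length (list_decode n)) = 0"
    using code_drop_list_encode[of "list_decode n" "length (list_decode n)"] by simp
  then show ?thesis ..
qed

text \<open>\<open>prod_encode (m, n)\<close> is \<open>triangle (m + n) + m\<close>, so
  \<open>pair\<close> needs only this function besides addition.\<close>

lemma recfn_triangle [recfn_intros]: "recfn k A \<Longrightarrow> recfn k (\<lambda>e. triangle (A e))"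
proof (erule recfn_comp1)
  have "triangle = rec_nat 0 (\<lambda>n r. r + Suc n)"
  proof
    show "triangle b = rec_nat 0 (\<lambda>n r. r + Suc n) b" for b by (induction b) simp_all
  qed
  moreover have "recfn 1 (\<lambda>e. rec_nat 0 (\<lambda>n r. r + Suc n) (e 0))"
    by (intro recfn_intros) simp_all
  ultimately show "recfn 1 (\<lambda>e. triangle (e 0))" by simp
qed

lemma recfn_pair [recfn_intros]: "recfn k A \<Longrightarrow> recfn k B \<Longrightarrow> recfn k (\<lambda>e. pair (A e) (B e))"
  unfolding pair_def prod_encode_def prod.case by (intro recfn_intros)

lemma recfn_code_cons [recfn_intros]:
  "recfn k A \<Longrightarrow> recfn k B \<Longrightarrow> recfn k (\<lambda>e. code_cons (A e) (B e))"
  unfolding code_cons_def by (intro recfn_intros)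

text \<open>Decoding is done by search. The second component is at most the code, which bounds the
  inner quantifier and keeps the condition decidable.\<close>

lemma recfn_fst_decode [recfn_intros]:
  "recfn k A \<Longrightarrow> recfn k (\<lambda>e. fst (prod_decode (A e)))"
proof (erule recfn_comp1)
  have ex: "\<exists>b<Suc n. n = pair (fst (prod_decode n)) b" for n
    using le_prod_encode_2[of "snd (prod_decode n)" "fst (prod_decode n)"]
    by (intro exI[of _ "snd (prod_decode n)"]) (simp add: pair_def)
  have "(LEAST a. \<exists>b<Suc n. n = pair a b) = fst (prod_decode n)" for n
    by (rule Least_equality) (use ex in \<open>auto simp: pair_def\<close>)
  moreover have "recfn 1 (\<lambda>e. LEAST a. \<exists>b<Suc (e 0). e 0 = pair a b)"
    by (intro recfn_intros) (simp_all, use ex in blast)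
  ultimately show "recfn 1 (\<lambda>e. fst (prod_decode (e 0)))" by simp
qed

lemma recfn_snd_decode [recfn_intros]:
  "recfn k A \<Longrightarrow> recfn k (\<lambda>e. snd (prod_decode (A e)))"
proof (erule recfn_comp1)
  have *: "n = pair (fst (prod_decode n)) b \<longleftrightarrow> b = snd (prod_decode n)" for n b
    using pair_eq_iff[of "fst (prod_decode n)" "snd (prod_decode n)" "fst (prod_decode n)" b]
    by (auto simp: pair_def)
  then have "(LEAST b. n = pair (fst (prod_decode n)) b) = snd (prod_decode n)" for n
    by (intro Least_equality) (simp_all only: *)
  moreover have "recfn 1 (\<lambda>e. LEAST b. e 0 = pair (fst (prod_decode (e 0))) b)"
    by (intro recfn_intros) (simp_all add: *)
  ultimately show "recfn 1 (\<lambda>e. snd (prod_decode (e 0)))" by simp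
qed

lemma recfn_code_drop [recfn_intros]:
  "recfn k A \<Longrightarrow> recfn k B \<Longrightarrow> recfn k (\<lambda>e. code_drop (A e) (B e))"
  unfolding code_drop_def code_tl_def by (intro recfn_intros) simp_all

lemma recfn_code_nth [recfn_intros]:
  "recfn k A \<Longrightarrow> recfn k B \<Longrightarrow> recfn k (\<lambda>e. code_nth (A e) (B e))"
  unfolding code_nth_def by (intro recfn_intros)

lemma recfn_code_length [recfn_intros]: "recfn k A \<Longrightarrow> recfn k (\<lambda>e. code_length (A e))"
proof (erule recfn_comp1)
  show "recfn 1 (\<lambda>e. code_length (e 0))"
    unfolding code_length_def by (intro recfn_intros ex_code_drop_0) simp_all
qed

section \<open>Derivations of evaluations\<close>

fun prog_code :: "prog \<Rightarrow> nat" where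
  "prog_code Zero = pair 0 0"
| "prog_code Succ = pair 1 0"
| "prog_code (Proj i) = pair 2 i"
| "prog_code (Comp f gs) = pair 3 (pair (prog_code f) (list_encode (map prog_code gs)))"
| "prog_code (PrimRec f g) = pair 4 (pair (prog_code f) (prog_code g))"
| "prog_code (Mu f) = pair 5 (prog_code f)"

definition eval_code :: "nat \<Rightarrow> nat \<Rightarrow> nat \<Rightarrow> nat" where
  "eval_code p xs y = pair p (pair xs y)"

lemma eval_code_eq_iff [simp]:
  "eval_code p xs y = eval_code p' xs' y' \<longleftrightarrow> p = p' \<and> xs = xs' \<and> y = y'"
  by (simp add: eval_code_def)

text \<open>\<open>p\<close>, \<open>xs\<close>, \<open>y\<close> follow from the codes in \<open>S\<close> by one rule of \<open>evaluates\<close> (in the order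
  of the rules). The bound \<open>b\<close> on all witnesses serves only to make the relation decidable.\<close>

definition rule_instance :: "nat \<Rightarrow> (nat \<Rightarrow> bool) \<Rightarrow> nat \<Rightarrow> nat \<Rightarrow> nat \<Rightarrow> bool" where
  "rule_instance b S p xs y \<longleftrightarrow>
    p = pair 0 0 \<and> y = 0 \<or>
    p = pair 1 0 \<and> (\<exists>x<b. y = Suc x \<and> xs = code_cons x 0) \<or>
    (\<exists>i<code_length xs. p = pair 2 i \<and> y = code_nth xs i) \<or>
    (\<exists>f<b. \<exists>gs<b. \<exists>ys<b. p = pair 3 (pair f gs) \<and> code_length ys = code_length gs \<and>
      (\<forall>i<code_length gs. S (eval_code (code_nth gs i) xs (code_nth ys i))) \<and>
      S (eval_code f ys y)) \<or>
    (\<exists>f<b. \<exists>g<b. \<exists>zs<b. p = pair 4 (pair f g) \<and> xs = code_cons 0 zs \<and> S (eval_code f zs y)) \<or>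
    (\<exists>f<b. \<exists>g<b. \<exists>zs<b. \<exists>n<b. \<exists>r<b. p = pair 4 (pair f g) \<and> xs = code_cons (Suc n) zs \<and>
      S (eval_code p (code_cons n zs) r) \<and> S (eval_code g (code_cons n (code_cons r zs)) y)) \<or>
    (\<exists>f<b. p = pair 5 f \<and> S (eval_code f (code_cons y xs) 0) \<and>
      (\<forall>m<y. \<exists>l<b. S (eval_code f (code_cons m xs) (Suc l))))"

text \<open>Premises come from strictly earlier entries, which makes induction on the position
  possible.\<close>

definition derivation :: "nat \<Rightarrow> nat \<Rightarrow> bool" where
  "derivation b d \<longleftrightarrow> (\<forall>i<code_length d. \<exists>p<b. \<exists>xs<b. \<exists>y<b. code_nth d i = eval_code p xs y \<and>
    rule_instance b (\<lambda>j. \<exists>m<i. code_nth d m = j) p xs y)"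

text \<open>\<open>s\<close> packs the bound together with the derivation, so that a search over \<open>s\<close> needs no
  estimate of either.\<close>

definition halts :: "nat \<Rightarrow> nat \<Rightarrow> nat \<Rightarrow> nat \<Rightarrow> bool" where
  "halts p x y s \<longleftrightarrow> (let d = snd (prod_decode s) in derivation (fst (prod_decode s)) d \<and>
     0 < code_length d \<and> code_nth d (code_length d - 1) = eval_code p (code_cons x 0) y)"

text \<open>Once unfolded, every quantifier is bounded by a computable term, so the closure rules
  apply.\<close>

lemma recpred_halts: "recpred 4 (\<lambda>e. halts (e 0) (e 1) (e 2) (e 3))"
  unfolding halts_def derivation_def rule_instance_def Let_def eval_code_def
  by (intro recfn_intros) simp_all

section \<open>Completeness: every evaluation has a derivation\<close>

lemma ex_less_mono:
  fixes b b' :: nat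
  assumes "b \<le> b'" and "\<And>x. P x \<longrightarrow> Q x"
  shows "(\<exists>x<b. P x) \<longrightarrow> (\<exists>x<b'. Q x)"
  using assms by (meson less_le_trans)

text \<open>\<open>S\<close> and the bound occur only positively: \<open>b\<close> bounds
  existential quantifiers, never a universal one.\<close>

lemma rule_instance_mono:
  assumes "b \<le> b'" and "\<And>j. S j \<longrightarrow> S' j"
  shows "rule_instance b S p xs y \<longrightarrow> rule_instance b' S' p xs y"
  unfolding rule_instance_def
  by (intro disj_mono conj_mono ex_less_mono[OF assms(1)] ex_mono all_mono imp_mono assms(2) imp_refl)

lemma rule_instance_Comp:
  assumes "f < b" "gs < b" "ys < b" "code_length ys = code_length gs"
    and "\<And>i. i < code_length gs \<Longrightarrow> S (eval_code (code_nth gs i) xs (code_nth ys i))"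
    and "S (eval_code f ys y)"
  shows "rule_instance b S (pair 3 (pair f gs)) xs y"
  using assms by (auto simp: rule_instance_def)

lemma rule_instance_PrimRec_Suc:
  assumes "f < b" "g < b" "zs < b" "n < b" "r < b"
    and "S (eval_code (pair 4 (pair f g)) (code_cons n zs) r)"
    and "S (eval_code g (code_cons n (code_cons r zs)) y)"
  shows "rule_instance b S (pair 4 (pair f g)) (code_cons (Suc n) zs) y"
  using assms by (simp add: rule_instance_def) blast

lemma rule_instance_Mu:
  assumes "f < b" "S (eval_code f (code_cons y xs) 0)"
    and "\<And>m. m < y \<Longrightarrow> \<exists>l<b. S (eval_code f (code_cons m xs) (Suc l))"
  shows "rule_instance b S (pair 5 f) xs y"
  using assms by (auto simp: rule_instance_def)

lemma derivation_list_encode_iff: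
  "derivation b (list_encode D) \<longleftrightarrow> (\<forall>i<length D. \<exists>p<b. \<exists>xs<b. \<exists>y<b. D ! i = eval_code p xs y \<and>
    rule_instance b (\<lambda>j. j \<in> set (take i D)) p xs y)"
proof -
  have "(\<lambda>j. \<exists>m<i. code_nth (list_encode D) m = j) = (\<lambda>j. j \<in> set (take i D))"
    if "i < length D" for i
  proof
    fix j
    show "(\<exists>m<i. code_nth (list_encode D) m = j) \<longleftrightarrow> j \<in> set (take i D)"
      using that by (auto simp: in_set_conv_nth)
  qed
  then show ?thesis unfolding derivation_def by simp
qed

text \<open>Every entry keeps its premises, as the earlier entries of its own part are still earlier
  in the whole list, and the bound only grows.\<close>

lemma derivation_append:
  assumes "derivation b (list_encode D)" and "derivation b' (list_encode D')"
  shows "derivation (max b b') (list_encode (D @ D'))"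
  unfolding derivation_list_encode_iff
proof (intro allI impI)
  fix i assume i: "i < length (D @ D')"
  show "\<exists>p<max b b'. \<exists>xs<max b b'. \<exists>y<max b b'. (D @ D') ! i = eval_code p xs y \<and>
    rule_instance (max b b') (\<lambda>j. j \<in> set (take i (D @ D'))) p xs y"
  proof (cases "i < length D")
    case True
    with assms(1) obtain p xs y where "p < b" "xs < b" "y < b" "D ! i = eval_code p xs y"
      "rule_instance b (\<lambda>j. j \<in> set (take i D)) p xs y"
      unfolding derivation_list_encode_iff by blast
    with True show ?thesis
      using rule_instance_mono[of b "max b b'" "\<lambda>j. j \<in> set (take i D)"
          "\<lambda>j. j \<in> set (take i (D @ D'))" p xs y]
      by (auto simp: nth_append less_max_iff_disj)
  next
    case False
    define l where "l = i - length D"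
    with False i have "l < length D'" by simp
    with assms(2) obtain p xs y where "p < b'" "xs < b'" "y < b'" "D' ! l = eval_code p xs y"
      "rule_instance b' (\<lambda>j. j \<in> set (take l D')) p xs y"
      unfolding derivation_list_encode_iff by blast
    with False show ?thesis
      using rule_instance_mono[of b' "max b b'" "\<lambda>j. j \<in> set (take l D')"
          "\<lambda>j. j \<in> set (take i (D @ D'))" p xs y]
      by (auto simp: nth_append less_max_iff_disj l_def)
  qed
qed

text \<open>The judgment has to come last because \<open>halts\<close> reads the value off the last
  entry.\<close>

definition derivable :: "nat \<Rightarrow> bool" where
  "derivable j \<longleftrightarrow> (\<exists>b D. derivation b (list_encode (D @ [j])))"

text \<open>Concatenation collects all premises of a rule in one list, however many
  \<open>Comp\<close> or \<open>Mu\<close> may have.\<close>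

lemma derivable_finite:
  assumes "finite A" and "\<And>j. j \<in> A \<Longrightarrow> derivable j"
  shows "\<exists>b D. derivation b (list_encode D) \<and> A \<subseteq> set D"
  using assms
proof (induction A rule: finite_induct)
  case empty
  have "derivation 0 (list_encode [])" by (simp only: derivation_list_encode_iff) simp
  then show ?case by blast
next
  case (insert a A)
  then obtain b D where D: "derivation b (list_encode D)" "A \<subseteq> set D" by blast
  from insert.prems obtain b' D' where "derivation b' (list_encode (D' @ [a]))"
    unfolding derivable_def by blast
  from derivation_append[OF D(1) this] D(2) show ?case
    by (intro exI[of _ "max b b'"] exI[of _ "D @ D' @ [a]"]) auto
qed

lemma derivable_step:
  assumes "finite A" and "\<And>j. j \<in> A \<Longrightarrow> derivable j" and "rule_instance b (\<lambda>j. j \<in> A) p xs y"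
  shows "derivable (eval_code p xs y)"
proof -
  obtain b' D where D: "derivation b' (list_encode D)" "A \<subseteq> set D"
    using derivable_finite[of A] assms(1,2) by blast
  \<comment> \<open>\<open>c\<close> exceeds not only both bounds but also the parts of the new
    judgment, which \<open>derivation\<close> requires to lie below its bound.\<close>
  define c where "c = Suc (b + b' + p + xs + y)"
  have le: "b \<le> c" "b' \<le> c" "p < c" "xs < c" "y < c" by (simp_all add: c_def)
  have step: "rule_instance c (\<lambda>j. j \<in> set D) p xs y"
    using rule_instance_mono[OF le(1), of "\<lambda>j. j \<in> A" "\<lambda>j. j \<in> set D" p xs y] assms(3) D(2) by blast
  have "derivation c (list_encode (D @ [eval_code p xs y]))"
    unfolding derivation_list_encode_iff
  proof (intro allI impI)
    fix i assume "i < length (D @ [eval_code p xs y])"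
    then consider "i < length D" | "i = length D" by fastforce
    then show "\<exists>p'<c. \<exists>xs'<c. \<exists>y'<c. (D @ [eval_code p xs y]) ! i = eval_code p' xs' y' \<and>
        rule_instance c (\<lambda>j. j \<in> set (take i (D @ [eval_code p xs y]))) p' xs' y'"
    proof cases
      case 1
      with D(1) obtain p' xs' y' where *: "p' < b'" "xs' < b'" "y' < b'" "D ! i = eval_code p' xs' y'"
        "rule_instance b' (\<lambda>j. j \<in> set (take i D)) p' xs' y'"
        unfolding derivation_list_encode_iff by blast
      with 1 le(2) rule_instance_mono[OF le(2), of "\<lambda>j. j \<in> set (take i D)" "\<lambda>j. j \<in> set (take i D)" p' xs' y']
      show ?thesis by (intro exI[of _ p'] conjI exI[of _ xs'] exI[of _ y']) (simp_all add: nth_append)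
    next
      case 2
      with step le show ?thesis by auto
    qed
  qed
  then show ?thesis unfolding derivable_def by blast
qed

text \<open>By induction on the evaluation: \<open>derivable_step\<close> is applied to the set of
  coded premises of the rule and a bound above the witnesses of its clause.\<close>

lemma evaluates_imp_derivable:
  "evaluates p xs y \<Longrightarrow> derivable (eval_code (prog_code p) (list_encode xs) y)"
proof (induction rule: evaluates.induct)
  case (Zero xs)
  show ?case by (rule derivable_step[of "{}" 0]) (simp_all add: rule_instance_def)
next
  case (Succ x)
  show ?case
    by (rule derivable_step[of "{}" "Suc x"])
      (simp_all add: rule_instance_def list_encode_Cons del: list_encode.simps(2))
next
  case (Proj i xs)
  then show ?case by (intro derivable_step[of "{}" 0]) (simp_all add: rule_instance_def)
next
  case (Comp ys gs xs f y)
  let ?A = "insert (eval_code (prog_code f) (list_encode ys) y)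
    ((\<lambda>i. eval_code (prog_code (gs ! i)) (list_encode xs) (ys ! i)) ` {..<length gs})"
  let ?b = "Suc (prog_code f + list_encode (map prog_code gs) + list_encode ys)"
  have "rule_instance ?b (\<lambda>j. j \<in> ?A) (prog_code (Comp f gs)) (list_encode xs) y"
    using Comp.hyps(1)
    unfolding prog_code.simps by (intro rule_instance_Comp[of _ _ _ "list_encode ys"]) auto
  then show ?case using Comp.IH by (intro derivable_step[of ?A ?b]) auto
next
  case (PrimRec_0 f xs y g)
  let ?A = "{eval_code (prog_code f) (list_encode xs) y}"
  let ?b = "Suc (prog_code f + prog_code g + list_encode xs)"
  have "rule_instance ?b (\<lambda>j. j \<in> ?A) (prog_code (PrimRec f g)) (list_encode (0 # xs)) y"
    by (simp add: rule_instance_def list_encode_Cons del: list_encode.simps(2))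
  then show ?case using PrimRec_0.IH by (intro derivable_step[of ?A ?b]) auto
next
  case (PrimRec_Suc f g n xs r y)
  let ?A = "{eval_code (prog_code (PrimRec f g)) (list_encode (n # xs)) r,
    eval_code (prog_code g) (list_encode (n # r # xs)) y}"
  let ?b = "Suc (prog_code f + prog_code g + list_encode xs + n + r)"
  have "rule_instance ?b (\<lambda>j. j \<in> ?A) (prog_code (PrimRec f g)) (list_encode (Suc n # xs)) y"
    unfolding prog_code.simps list_encode_Cons by (intro rule_instance_PrimRec_Suc[of _ _ _ _ _ r]) simp_all
  then show ?case using PrimRec_Suc.IH by (intro derivable_step[of ?A ?b]) auto
next
  case (Mu f n xs)
  from Mu.IH(2) obtain l where
    l: "\<And>m. m < n \<Longrightarrow> derivable (eval_code (prog_code f) (list_encode (m # xs)) (Suc (l m)))"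
    by metis
  let ?A = "insert (eval_code (prog_code f) (list_encode (n # xs)) 0)
    ((\<lambda>m. eval_code (prog_code f) (list_encode (m # xs)) (Suc (l m))) ` {..<n})"
  \<comment> \<open>The sum dominates every \<open>l m\<close> at once, so one bound serves all
    premises below \<open>n\<close>.\<close>
  let ?b = "Suc (prog_code f + sum l {..<n})"
  have "l m < ?b" if "m < n" for m
    using member_le_sum[of m "{..<n}" l] that by simp
  then have "rule_instance ?b (\<lambda>j. j \<in> ?A) (prog_code (Mu f)) (list_encode xs) n"
    unfolding prog_code.simps list_encode_Cons by (intro rule_instance_Mu) auto
  then show ?case using Mu.IH(1) l by (intro derivable_step[of ?A ?b]) auto
qed

section \<open>Soundness: derived judgments about programs are true\<close>

text \<open>Not every number is the code of a program, so a derivation may contain meaningless judgments;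
  those about codes of programs depend only on judgments about codes of programs.\<close>

lemma rule_instance_sound:
  assumes S: "\<And>q zs z. S (eval_code (prog_code q) (list_encode zs) z) \<Longrightarrow> evaluates q zs z"
    and "rule_instance b S (prog_code p) (list_encode xs) y"
  shows "evaluates p xs y"
proof (cases p)
  case Zero
  with assms(2) show ?thesis by (simp add: rule_instance_def evaluates.Zero)
next
  case Succ
  with assms(2) show ?thesis
    by (auto simp: rule_instance_def list_encode_eq_cons intro: evaluates.Succ)
next
  case (Proj i)
  with assms(2) show ?thesis by (auto simp: rule_instance_def intro: evaluates.Proj)
next
  case (Comp f gs)
  with assms(2) obtain c where c: "code_length c = length gs"
    "\<And>i. i < length gs \<Longrightarrow> S (eval_code (prog_code (gs ! i)) (list_encode xs) (code_nth c i))"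
    "S (eval_code (prog_code f) c y)"
    by (auto simp: rule_instance_def)
  \<comment> \<open>Unlike program codes, list codes are never meaningless: every number is
    \<open>list_encode\<close> of some list.\<close>
  define ys where "ys = list_decode c"
  then have "c = list_encode ys" by simp
  with c S show ?thesis unfolding Comp by (intro evaluates.Comp[of ys]) auto
next
  case (PrimRec f g)
  with assms(2) consider
    (zero) c where "list_encode xs = code_cons 0 c" "S (eval_code (prog_code f) c y)"
  | (suc) n c r where "list_encode xs = code_cons (Suc n) c"
      "S (eval_code (prog_code p) (code_cons n c) r)"
      "S (eval_code (prog_code g) (code_cons n (code_cons r c)) y)"
    by (auto simp: rule_instance_def)
  then show ?thesis
  proof cases
    case zero
    then show ?thesis
      using S[of f "list_decode c" y] by (simp add: PrimRec list_encode_eq_cons evaluates.PrimRec_0)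
  next
    case suc
    from suc(2,3) have "evaluates p (n # list_decode c) r" "evaluates g (n # r # list_decode c) y"
      by (auto intro!: S simp: list_encode_Cons simp del: list_encode.simps(2))
    with suc(1) show ?thesis by (auto simp: PrimRec list_encode_eq_cons intro: evaluates.PrimRec_Suc)
  qed
next
  case (Mu f)
  with assms(2) have *: "S (eval_code (prog_code f) (code_cons y (list_encode xs)) 0)"
    "\<And>m. m < y \<Longrightarrow> \<exists>l. S (eval_code (prog_code f) (code_cons m (list_encode xs)) (Suc l))"
    by (auto simp: rule_instance_def)
  then show ?thesis
    unfolding Mu list_encode_Cons[symmetric] by (intro evaluates.Mu) (use S in blast)+
qed

text \<open>By strong induction on \<open>i\<close>, since premises sit at smaller
  positions.\<close>

lemma derivation_sound:
  assumes "derivation b (list_encode D)"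
  shows "i < length D \<Longrightarrow> D ! i = eval_code (prog_code p) (list_encode xs) y \<Longrightarrow> evaluates p xs y"
proof (induction i arbitrary: p xs y rule: less_induct)
  case (less i)
  obtain p' xs' y' where "D ! i = eval_code p' xs' y'"
    "rule_instance b (\<lambda>j. j \<in> set (take i D)) p' xs' y'"
    using assms less.prems(1) unfolding derivation_list_encode_iff by blast
  with less.prems(2)
  have "rule_instance b (\<lambda>j. j \<in> set (take i D)) (prog_code p) (list_encode xs) y" by simp
  then show ?case
  proof (rule rule_instance_sound[rotated])
    show "evaluates q zs z" if "eval_code (prog_code q) (list_encode zs) z \<in> set (take i D)" for q zs z
    proof -
      from that obtain l where "l < i" "D ! l = eval_code (prog_code q) (list_encode zs) z"
        using less.prems(1) by (auto simp: in_set_conv_nth)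
      with less.prems(1) show ?thesis by (intro less.IH[of l]) simp_all
    qed
  qed
qed

lemma halts_complete:
  assumes "evaluates p [x] y"
  shows "\<exists>s. halts (prog_code p) x y s"
proof -
  obtain b D where "derivation b (list_encode (D @ [eval_code (prog_code p) (list_encode [x]) y]))"
    using evaluates_imp_derivable[OF assms] unfolding derivable_def by blast
  then have "halts (prog_code p) x y
      (prod_encode (b, list_encode (D @ [eval_code (prog_code p) (list_encode [x]) y])))"
    by (simp add: halts_def code_cons_def pair_def)
  then show ?thesis by blast
qed

lemma halts_sound:
  assumes "halts (prog_code p) x y s"
  shows "evaluates p [x] y"
proof -
  obtain D where D: "snd (prod_decode s) = list_encode D" by (metis list_decode_inverse)
  have "code_cons x 0 = list_encode [x]" by (simp add: list_encode_Cons del: list_encode.simps(2))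
  with assms D show ?thesis
    by (auto simp: halts_def Let_def intro: derivation_sound[of _ D "length D - 1"])
qed

text \<open>\<open>s\<close> determines the derivation, whose last entry contains the value. So the
  first success is unambiguous even when \<open>p\<close> codes no program.\<close>

lemma halts_functional: "halts p x y s \<Longrightarrow> halts p x z s \<Longrightarrow> y = z"
  by (simp add: halts_def Let_def)

section \<open>The Kleene tree\<close>

text \<open>Derivations about numbers that code no program need not be deterministic, hence the escape
  clause for a smaller \<open>t\<close>: only the value found first has to be avoided.\<close>

definition kleene_tree :: "nat list set" where
  "kleene_tree = {\<sigma>. set \<sigma> \<subseteq> {0, 1} \<and> (\<forall>e<length \<sigma>. \<forall>s<length \<sigma>.
    halts e e (\<sigma> ! e) s \<longrightarrow> (\<exists>t<s. halts e e (1 - \<sigma> ! e) t))}"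

lemma binary_tree_kleene_tree: "binary_tree kleene_tree"
  unfolding binary_tree_def
proof (intro conjI allI ballI impI)
  have "[] \<in> kleene_tree" by (simp add: kleene_tree_def)
  then show "kleene_tree \<noteq> {}" by blast
  show "set \<sigma> \<subseteq> {0, 1}" if "\<sigma> \<in> kleene_tree" for \<sigma>
    using that by (simp add: kleene_tree_def)
  show "\<sigma> \<in> kleene_tree" if "strict_prefix \<sigma> \<tau> \<and> \<tau> \<in> kleene_tree" for \<sigma> \<tau>
  \<comment> \<open>Shortening \<open>\<tau>\<close> only removes cases of \<open>e\<close> and
    \<open>s\<close>; the escape search is bounded by \<open>s\<close>, not by the length.\<close>
  proof -
    from that obtain \<rho> where \<rho>: "\<tau> = \<sigma> @ \<rho>" by (auto elim: strict_prefixE' prefixE)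
    have "\<exists>t<s. halts e e (1 - \<sigma> ! e) t"
      if "e < length \<sigma>" "s < length \<sigma>" "halts e e (\<sigma> ! e) s" for e s
    proof -
      have nth: "\<tau> ! e = \<sigma> ! e" using \<rho> that(1) by (simp add: nth_append)
      have "e < length \<tau>" "s < length \<tau>" using \<rho> that(1,2) by simp_all
      with that(3) \<open>strict_prefix \<sigma> \<tau> \<and> \<tau> \<in> kleene_tree\<close> show ?thesis
        unfolding nth[symmetric] kleene_tree_def by blast
    qed
    with that \<rho> show ?thesis by (simp add: kleene_tree_def)
  qed
qed

lemma infinite_if_branch:
  assumes "branch T f"
  shows "infinite T"
proof -
  have "inj (\<lambda>n. map f [0..<n])"
    by (rule injI) (auto dest: arg_cong[of _ _ length])
  then have "infinite (range (\<lambda>n. map f [0..<n]))" by (simp add: finite_image_iff)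
  moreover have "range (\<lambda>n. map f [0..<n]) \<subseteq> T" using assms by (auto simp: branch_def)
  ultimately show ?thesis using infinite_super by blast
qed

lemma ex_branch_kleene_tree: "\<exists>f. branch kleene_tree f"
proof -
  \<comment> \<open>The value is 1 if 0 is found at \<open>e\<close> strictly before 1, and 0
    otherwise: the value found first is avoided.\<close>
  define f :: "nat \<Rightarrow> nat"
    where "f e = of_bool (\<exists>s. halts e e 0 s \<and> (\<forall>t\<le>s. \<not> halts e e 1 t))" for e
  have "\<exists>t<s. halts e e (1 - f e) t" if s: "halts e e (f e) s" for e s
  proof (cases "f e = 0")
    case True
    with s have "halts e e 0 s" by simp
    with True obtain t where "t \<le> s" "halts e e 1 t" by (auto simp: f_def)
    \<comment> \<open>One \<open>s\<close> cannot yield both 0 and 1, so \<open>t\<close> lies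
      strictly below \<open>s\<close>.\<close>
    moreover from this have "t \<noteq> s" using s True halts_functional by force
    ultimately show ?thesis using True by (intro exI[of _ t]) simp
  next
    case False
    then have one: "f e = 1" by (simp add: f_def)
    from False obtain t where "halts e e 0 t" "\<forall>u\<le>t. \<not> halts e e 1 u"
      by (auto simp: f_def)
    with s one show ?thesis by (intro exI[of _ t]) (auto simp: not_le[symmetric])
  qed
  moreover have "f e = 0 \<or> f e = 1" for e by (simp add: f_def)
  ultimately have "branch kleene_tree f"
    by (simp add: branch_def kleene_tree_def image_subset_iff)
  then show ?thesis by blast
qed

lemma computable_tree_kleene_tree: "computable_tree kleene_tree"
proof -
  define P where "P n \<longleftrightarrow> (\<forall>i<code_length n. code_nth n i < 2) \<and>
    (\<forall>e<code_length n. \<forall>s<code_length n.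
      halts e e (code_nth n e) s \<longrightarrow> (\<exists>t<s. halts e e (1 - code_nth n e) t))" for n
  have mem: "n \<in> list_encode ` kleene_tree \<longleftrightarrow> P n" for n
  proof -
    obtain \<sigma> where \<sigma>: "n = list_encode \<sigma>" by (metis list_decode_inverse)
    have "set \<sigma> \<subseteq> {0, 1} \<longleftrightarrow> (\<forall>i<length \<sigma>. \<sigma> ! i < 2)"
      by (auto simp: subset_iff all_set_conv_all_nth less_Suc_eq in_set_conv_nth)
    then have "\<sigma> \<in> kleene_tree \<longleftrightarrow> P n" by (simp add: kleene_tree_def P_def \<sigma>)
    then show ?thesis using \<sigma> inj_image_mem_iff[OF inj_list_encode] by simp
  qed
  \<comment> \<open>Substitution turns computability on four variables into a closure rule for use
    under the quantifiers of \<open>P\<close>.\<close>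
  have halts [recfn_intros]: "recpred k (\<lambda>e. halts (A e) (B e) (C e) (D e))"
    if "recfn k A" "recfn k B" "recfn k C" "recfn k D" for k A B C D
  proof -
    have "recfn k ([A, B, C, D] ! i)" if "i < 4" for i
      using that \<open>recfn k A\<close> \<open>recfn k B\<close> \<open>recfn k C\<close> \<open>recfn k D\<close>
      by (auto simp: less_Suc_eq numeral_eq_Suc)
    from recfn_comp[of 4 _ k "\<lambda>i. [A, B, C, D] ! i", OF recpred_halts[unfolded recpred_def] this]
    show ?thesis by (simp add: recpred_def)
  qed
  have "recpred 1 (\<lambda>e. P (e 0))"
    unfolding P_def by (intro recfn_intros) simp_all
  then obtain p where "\<And>e. evaluates p (map e [0..<1]) (of_bool (P (e 0)))"
    unfolding recpred_def recfn_def by blast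
  from this[of "\<lambda>_. _"] have "evaluates p [n] (of_bool (P n))" for n by simp
  then show ?thesis
    unfolding computable_tree_def computable_set_def computable_def mem of_bool_def by blast
qed

text \<open>Diagonal argument at the program's own code \<open>e\<close>: the value
  \<open>f e\<close> is found at some \<open>s\<close>, and the escape clause would give
  \<open>p\<close> a second value at \<open>e\<close>, which determinism excludes.\<close>

lemma not_computable_branch_kleene_tree:
  assumes "branch kleene_tree f"
  shows "\<not> computable f"
proof
  assume "computable f"
  then obtain p where p: "\<And>x. evaluates p [x] (f x)" unfolding computable_def by blast
  define e where "e = prog_code p"
  obtain s where s: "halts e e (f e) s" using halts_complete[OF p] unfolding e_def by blast
  \<comment> \<open>This length exceeds both \<open>e\<close> and \<open>s\<close>, so that the tree
    condition covers them.\<close>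
  let ?\<sigma> = "map f [0..<Suc (e + s)]"
  have nth: "?\<sigma> ! e = f e" by (simp del: upt_Suc)
  have "?\<sigma> \<in> kleene_tree" using assms unfolding branch_def by blast
  moreover have "e < length ?\<sigma>" "s < length ?\<sigma>" "halts e e (?\<sigma> ! e) s"
    using s unfolding nth by simp_all
  ultimately have "\<exists>t<s. halts e e (1 - ?\<sigma> ! e) t" unfolding kleene_tree_def by blast
  then obtain t where "halts e e (1 - f e) t" unfolding nth by blast
  then have "evaluates p [e] (1 - f e)" unfolding e_def by (rule halts_sound)
  with p[of e] have "f e = 1 - f e" by (rule evaluates_deterministic)
  then show False by presburger
qed

theorem theorem5p2p1:
  shows "\<exists>T. binary_tree T \<and> infinite T \<and> computable_tree T \<and>
    \<not> (\<exists>f. branch T f \<and> computable f)"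
  using binary_tree_kleene_tree computable_tree_kleene_tree not_computable_branch_kleene_tree
    ex_branch_kleene_tree infinite_if_branch by blast

end
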